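(* Let $\alpha>0$ and suppose the random collection $\boldsymbol{\mathcal R}\subseteq 2^{[m]}$ has simultaneous control of the FDR at level $\alpha$, i.e. $\mathbb E_{\mathrm P}\big(\max_{R\in\boldsymbol{\mathcal R}}\mathrm{FDP}_{N_{\mathrm P}}(R)\big)\le\alpha$ for every $\mathrm P\in M$. Define $\mathbf R=\{i\in[m]:\{i\}\in\boldsymbol{\mathcal R}\}$. Then $\mathbf R$ controls FWER at level $\alpha$, that is, for every $\mathrm P\in M$, $\mathrm P(\mathbf R\cap N_{\mathrm P}=\emptyset)\ge1-\alpha$.
   Context: Setting: $M$ is a set of probability measures on a measurable space; $m\ge 1$, $[m]=\{1,\dots,m\}$; hypotheses $H_1,\dots,H_m\subseteq M$; for $\mathrm P\in M$, $N_{\mathrm P}=\{i\in[m]:\mathrm P\in H_i\}$. A random collection is a measurable function with values in $2^{2^{[m]}}$; it is assumed to be never empty (without loss, since $\emptyset$ may always be added to it). $\mathrm{FDP}_N(R)=|R\cap N|/(|R|\vee1)$. *)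

theory Defs
  imports "HOL-Probability.Probability"
begin

definition true_nulls :: "nat \<Rightarrow> (nat \<Rightarrow> 'a measure set) \<Rightarrow> 'a measure \<Rightarrow> nat set" where
  "true_nulls m H P = {i \<in> {1..m}. P \<in> H i}"

definition FDP :: "nat set \<Rightarrow> nat set \<Rightarrow> real" where
  "FDP N R = real (card (R \<inter> N)) / real (max (card R) 1)"

(* \<Omega> only carries the measurable space; its measure values are irrelevant. *)
definition random_collection :: "'a measure \<Rightarrow> nat \<Rightarrow> ('a \<Rightarrow> nat set set) \<Rightarrow> bool" where
  "random_collection \<Omega> m \<R> \<longleftrightarrow>
     \<R> \<in> measurable \<Omega> (count_space (Pow (Pow {1..m}))) \<and>
     (\<forall>\<omega>\<in>space \<Omega>. \<R> \<omega> \<noteq> {})"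

(* For a random collection the integrand is bounded and measurable, hence integrable with
   respect to every P in M, so the Bochner integral is the usual expectation. *)
definition simultaneous_FDR_control ::
    "'a measure set \<Rightarrow> nat \<Rightarrow> (nat \<Rightarrow> 'a measure set) \<Rightarrow> real \<Rightarrow> ('a \<Rightarrow> nat set set) \<Rightarrow> bool" where
  "simultaneous_FDR_control M m H \<alpha> \<R> \<longleftrightarrow>
     (\<forall>P\<in>M. (\<integral>\<omega>. Max (FDP (true_nulls m H P) ` \<R> \<omega>) \<partial>P) \<le> \<alpha>)"

definition FWER_control ::
    "'a measure set \<Rightarrow> nat \<Rightarrow> (nat \<Rightarrow> 'a measure set) \<Rightarrow> real \<Rightarrow> ('a \<Rightarrow> nat set) \<Rightarrow> bool" where
  "FWER_control M m H \<alpha> R \<longleftrightarrow>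
     (\<forall>P\<in>M. measure P {\<omega> \<in> space P. R \<omega> \<inter> true_nulls m H P = {}} \<ge> 1 - \<alpha>)"

definition singleton_rejections :: "nat \<Rightarrow> ('a \<Rightarrow> nat set set) \<Rightarrow> 'a \<Rightarrow> nat set" where
  "singleton_rejections m \<R> \<omega> = {i \<in> {1..m}. {i} \<in> \<R> \<omega>}"

end

(* When R meets N, the collection contains a singleton {i} with i in N, whose FDP is 1. Hence the
   indicator of the event that R meets N is at most the maximal FDP, whose expectation is at most
   alpha. *)
theory Submission
  imports Defs
begin

lemma FDP_nonneg: "0 \<le> FDP N R"
  by (simp add: FDP_def)

text \<open>The numerator counts a subset of \<open>R\<close>. Finiteness matters: an infinite
  \<open>R\<close> has \<open>card R = 0\<close>, so the denominator is 1, while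
  \<open>R \<inter> N\<close> may be finite with several elements.\<close>

lemma FDP_le_1: "finite R \<Longrightarrow> FDP N R \<le> 1"
  by (auto simp: FDP_def card_mono le_max_iff_disj)

lemma FDP_true_null_singleton: "i \<in> N \<Longrightarrow> FDP N {i} = 1"
  by (simp add: FDP_def)

theorem theorem39:
  fixes \<Omega> :: "'a measure" and M :: "'a measure set"
    and m :: nat and H :: "nat \<Rightarrow> 'a measure set"
    and \<alpha> :: real and \<R> :: "'a \<Rightarrow> nat set set"
  assumes "\<And>P. P \<in> M \<Longrightarrow> prob_space P"
    and "\<And>P. P \<in> M \<Longrightarrow> sets P = sets \<Omega>"
    and "m \<ge> 1"
    and "\<And>i. i \<in> {1..m} \<Longrightarrow> H i \<subseteq> M"
    and "\<alpha> > 0"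
    and "random_collection \<Omega> m \<R>"
    and "simultaneous_FDR_control M m H \<alpha> \<R>"
  shows "FWER_control M m H \<alpha> (singleton_rejections m \<R>)"
  unfolding FWER_control_def
proof
  fix P assume P: "P \<in> M"
  interpret prob_space P using assms(1)[OF P] .
  define N where "N = true_nulls m H P"
  define f where "f = (\<lambda>\<omega>. Max (FDP N ` \<R> \<omega>))"
  define A where "A = {\<omega> \<in> space P. singleton_rejections m \<R> \<omega> \<inter> N \<noteq> {}}"
  have space_eq: "space P = space \<Omega>"
    using assms(2)[OF P] by (rule sets_eq_imp_space_eq)
  have meas[measurable]: "\<R> \<in> measurable P (count_space (Pow (Pow {1..m})))"
    using assms(6) measurable_cong_sets[OF assms(2)[OF P] refl]
    unfolding random_collection_def by blast
  have ne: "\<R> \<omega> \<noteq> {}" and sub: "\<R> \<omega> \<subseteq> Pow {1..m}" if "\<omega> \<in> space P" for \<omega>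
    using assms(6) that measurable_space[OF meas that]
    by (auto simp: random_collection_def space_eq)
  have fin: "finite (\<R> \<omega>)" if "\<omega> \<in> space P" for \<omega>
    using finite_subset[OF sub[OF that]] by simp
  \<comment> \<open>\<open>f\<close> factors through \<open>\<R>\<close>, and every real function on
    a \<open>count_space\<close> is measurable.\<close>
  have f_meas[measurable]: "f \<in> borel_measurable P"
    unfolding f_def by (rule measurable_compose[OF meas]) simp
  have f_upper: "FDP N R \<le> f \<omega>" if "\<omega> \<in> space P" "R \<in> \<R> \<omega>" for \<omega> R
    using that fin by (simp add: f_def)
  \<comment> \<open>Nonemptiness of \<open>\<R> \<omega>\<close> enters here: some member has a
    nonnegative FDP below the maximum, whereas \<open>Max {}\<close> is unspecified.\<close>
  have f_nonneg: "0 \<le> f \<omega>" if "\<omega> \<in> space P" for \<omega>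
    using ne[OF that] f_upper[OF that] FDP_nonneg order_trans by blast
  have f_le_1: "f \<omega> \<le> 1" if "\<omega> \<in> space P" for \<omega>
  proof -
    have "finite R" if "R \<in> \<R> \<omega>" for R
      using sub[OF \<open>\<omega> \<in> space P\<close>] that finite_subset[of R "{1..m}"] by auto
    then show ?thesis
      using ne[OF that] fin[OF that] FDP_le_1 by (simp add: f_def)
  qed
  have A_ev: "A \<in> events"
  proof -
    have "A = \<R> -` {C. \<exists>i\<in>{1..m} \<inter> N. {i} \<in> C} \<inter> space P"
      by (auto simp: A_def singleton_rejections_def)
    \<comment> \<open>Only subsets of \<open>Pow (Pow {1..m})\<close> are measurable in the target
      space, so the set of collections is cut down to it; the preimage does not change.\<close>
    also have "\<dots> = \<R> -` ({C. \<exists>i\<in>{1..m} \<inter> N. {i} \<in> C} \<inter> Pow (Pow {1..m})) \<inter> space P"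
      using sub by blast
    also have "\<dots> \<in> events"
      by (rule measurable_sets[OF meas]) simp
    finally show ?thesis .
  qed
  \<comment> \<open>On \<open>A\<close>, a rejected true null \<open>i\<close> puts
    \<open>{i}\<close>, of FDP 1, into the collection; off \<open>A\<close>, nonnegativity of
    \<open>f\<close> suffices.\<close>
  have A_le_f: "indicator A \<omega> \<le> f \<omega>" if "\<omega> \<in> space P" for \<omega>
  proof (cases "\<omega> \<in> A")
    case True
    then obtain i where "{i} \<in> \<R> \<omega>" "i \<in> N"
      by (auto simp: A_def singleton_rejections_def)
    then show ?thesis
      using f_upper[OF that] FDP_true_null_singleton True by fastforce
  qed (simp add: f_nonneg that)
  \<comment> \<open>Monotonicity of the Bochner integral needs this, since the integral of a
    non-integrable function defaults to 0.\<close>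
  have "integrable P f"
    by (rule integrable_const_bound[where B = 1]) (use f_nonneg f_le_1 in auto)
  then have "prob A \<le> (\<integral>\<omega>. f \<omega> \<partial>P)"
    using integral_mono[of P "indicator A" f] A_ev A_le_f by (simp add: emeasure_eq_measure)
  also have "\<dots> \<le> \<alpha>"
    using assms(7) P by (simp add: simultaneous_FDR_control_def f_def N_def)
  finally have "1 - \<alpha> \<le> prob (space P - A)"
    using prob_compl[OF A_ev] by simp
  also have "space P - A = {\<omega> \<in> space P. singleton_rejections m \<R> \<omega> \<inter> true_nulls m H P = {}}"
    by (auto simp: A_def N_def)
  finally show "1 - \<alpha> \<le> prob {\<omega> \<in> space P. singleton_rejections m \<R> \<omega> \<inter> true_nulls m H P = {}}" .
qed

end
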